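(* Fix a positive integer $m$, an integer $n'\ge0$ and a prime $p$. For any given infinite integer sequence $b_0,b_1,\dots$ with $m=b_0\ge b_1\ge\cdots\ge b_i\ge b_{i+1}\ge\cdots\ge0$, let ${\boldsymbol b}^s=(b_1,\dots,b_s)$. Then $$\lim_{s\to\infty}f(p,s,m,n',{\boldsymbol b}^s)=\begin{cases}0,&\text{if }\sum_{i=1}^{\infty}b_i=\infty,\\[4pt] p^{-\sum_{i=1}^{r}(n'+b_i)b_i}\cdot\dfrac{[p,n'+m][p,m]}{[p,n']\prod_{i=1}^{r+1}[p,b_{i-1}-b_i]},&\text{otherwise,}\end{cases}$$ where in the second case $r$ is the number of nonzero terms among $b_1,b_2,\dots$, which is finite, and $b_{r+1}=0$.
   Context: $[p,0]=1$ and $[p,\ell]=\prod_{j=1}^{\ell}(1-p^{-j})$ for $\ell\ge1$. For an integer vector ${\boldsymbol b}=(b_1,\dots,b_s)$ with $m=b_0\ge b_1\ge\cdots\ge b_s\ge0$, $$f(p,s,m,n',{\boldsymbol b})=p^{-\sum_{i=1}^{s}(n'+b_i)b_i}\cdot\frac{[p,n'+m][p,m]}{[p,n'+b_s][p,b_s]\prod_{i=1}^{s}[p,b_{i-1}-b_i]}.$$ *)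

theory Defs
  imports "HOL-Analysis.Analysis" "HOL-Computational_Algebra.Primes"
begin

definition br :: "nat \<Rightarrow> nat \<Rightarrow> real" where
  "br p l = (\<Prod>j=1..l. 1 - real p powi (- int j))"

(* The vector (b_1, ..., b_s) is given as a function of which only the values at 1, ..., s
   are used; the value at 0 is overridden by the convention b_0 = m.  The natural-number
   subtraction c (i - 1) - c i is exact for m = b_0 >= b_1 >= ... >= b_s, which is the only
   case where the formula is meant to be used. *)
definition f_val :: "nat \<Rightarrow> nat \<Rightarrow> nat \<Rightarrow> nat \<Rightarrow> (nat \<Rightarrow> nat) \<Rightarrow> real" where
  "f_val p s m n' b =
    (let c = b(0 := m) in
      real p powi (- int (\<Sum>i=1..s. (n' + c i) * c i)) *
      ((br p (n' + m) * br p m) /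
       (br p (n' + c s) * br p (c s) * (\<Prod>i=1..s. br p (c (i - 1) - c i)))))"

end

theory Submission
  imports Defs
begin

text \<open>
  A non-increasing sequence of naturals is eventually constant, with value \<open>c\<close> say.  Once \<open>b\<close> no
  longer drops, passing from \<open>s\<close> to \<open>s + 1\<close> adds only the factor \<open>[p, 0] = 1\<close> to the product and the
  summand \<open>(n' + c) c\<close> to the exponent.  Hence \<open>f\<close> is eventually a geometric sequence with ratio
  \<open>p\<^bsup>-(n' + c) c\<^esup>\<close>
  (lemma \<open>f_val_Suc_if_stationary\<close>).

  If \<open>c > 0\<close>, the ratio is less than \<open>1\<close> and the limit is \<open>0\<close>; if \<open>c = 0\<close>, the ratio is \<open>1\<close> and
  the limit is the value at any index where \<open>b\<close> vanishes.  The first such index is \<open>r + 1\<close>, and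
  there \<open>f\<close> has the stated form.  The two cases are those of the theorem because a
  series of naturals diverges exactly when infinitely many terms are nonzero, which for a
  non-increasing sequence means that no term vanishes
  (lemma \<open>suminf_decreasing_nat_eq_top_iff\<close>).
\<close>

lemma decseq_nat_eventually_constant:
  fixes b :: "nat \<Rightarrow> nat"
  assumes "decseq b"
  obtains N where "\<And>i. i \<ge> N \<Longrightarrow> b i = b N"
proof -
  obtain N where N: "\<And>i. b N \<le> b i"
    using ex_has_least_nat[of "\<lambda>_. True" 0 b] by auto
  show thesis
    using that[of N] N decseqD[OF assms] by (meson antisym)
qed

text \<open>
  A vanishing term leaves a finite sum of naturals, since all later terms vanish with it;
  otherwise all terms are at least \<open>1\<close> and the partial sums exceed every natural.
\<close>

lemma suminf_decreasing_nat_eq_top_iff: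
  fixes b :: "nat \<Rightarrow> nat"
  assumes "decseq b"
  shows "(\<Sum>i. of_nat (b (Suc i)) :: ennreal) = \<infinity> \<longleftrightarrow> (\<forall>i. b i \<noteq> 0)"
proof
  assume inf: "(\<Sum>i. of_nat (b (Suc i)) :: ennreal) = \<infinity>"
  show "\<forall>i. b i \<noteq> 0"
  proof (rule ccontr)
    assume "\<not> (\<forall>i. b i \<noteq> 0)"
    then obtain k where k: "b k = 0" by auto
    have "b (Suc i) = 0" if "i \<notin> {..<k}" for i
      using decseqD[OF assms, of k "Suc i"] k that by simp
    then have "(\<Sum>i. of_nat (b (Suc i)) :: ennreal) = (\<Sum>i<k. of_nat (b (Suc i)))"
      by (intro suminf_finite) auto
    also have "\<dots> = of_nat (\<Sum>i<k. b (Suc i))" by simp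
    finally show False using inf of_nat_less_top by (metis infinity_ennreal_def less_irrefl)
  qed
next
  assume pos: "\<forall>i. b i \<noteq> 0"
  have le: "of_nat n \<le> (\<Sum>i. of_nat (b (Suc i)) :: ennreal)" for n
  proof -
    have "n = (\<Sum>i<n. 1)" by simp
    also have "\<dots> \<le> (\<Sum>i<n. b (Suc i))"
      using pos by (intro sum_mono) (simp add: Suc_leI)
    finally have "of_nat n \<le> (of_nat (\<Sum>i<n. b (Suc i)) :: ennreal)" by (rule of_nat_mono)
    also have "\<dots> = (\<Sum>i<n. of_nat (b (Suc i)))" by simp
    also have "\<dots> \<le> (\<Sum>i. of_nat (b (Suc i)))" by (intro sum_le_suminf) auto
    finally show ?thesis .
  qed
  show "(\<Sum>i. of_nat (b (Suc i)) :: ennreal) = \<infinity>"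
    using le ennreal_Ex_less_of_nat by (metis infinity_ennreal_def leD top.not_eq_extremum)
qed

lemma br_0 [simp]: "br p 0 = 1"
  by (simp add: br_def)

text \<open>
  The denominators \<open>[p, n' + b\<^sub>s]\<close> and \<open>[p, b\<^sub>s]\<close> also depend on \<open>s\<close>, but only through
  \<open>b\<^sub>s\<close>; so where \<open>b\<close> does not drop, only the power of \<open>p\<close> changes.
\<close>

lemma f_val_Suc_if_stationary:
  assumes "p > 0" and "b 0 = m" and "b (Suc s) = b s"
  shows "f_val p (Suc s) m n' b = f_val p s m n' b * real p powi (- int ((n' + b s) * b s))"
proof -
  have "b(0 := m) = b" using assms by auto
  moreover have "real p powi (- A - B) = real p powi (- A) * real p powi (- B)" for A B
    using assms(1) power_int_add[of "real p" "- A" "- B"] by simp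
  ultimately show ?thesis
    using assms(3) by (simp add: f_val_def)
qed

lemma f_val_geometric:
  assumes "p > 0" and "b 0 = m" and const: "\<And>i. i \<ge> N \<Longrightarrow> b i = c"
  shows "f_val p (N + k) m n' b = f_val p N m n' b * (real p powi (- int ((n' + c) * c))) ^ k"
proof (induction k)
  case (Suc k)
  then show ?case
    using f_val_Suc_if_stationary[of p b m "N + k" n'] assms(1,2) const by simp
qed simp

lemma f_val_Suc_eq_if_zero:
  assumes "b 0 = m" and "b (Suc r) = 0"
  shows "f_val p (Suc r) m n' b =
    real p powi (- int (\<Sum>i=1..r. (n' + b i) * b i)) *
    ((br p (n' + m) * br p m) / (br p n' * (\<Prod>i=1..r+1. br p (b (i - 1) - b i))))"
proof -
  have "b(0 := m) = b" using assms by auto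
  then show ?thesis using assms(2) by (simp add: f_val_def)
qed

theorem theorem5p11:
  fixes p m n' :: nat and b :: "nat \<Rightarrow> nat"
  assumes "m > 0" and "prime p"
    and "b 0 = m" and "\<And>i. b (Suc i) \<le> b i"
  shows "((\<Sum>i. of_nat (b (Suc i)) :: ennreal) = \<infinity> \<longrightarrow>
            (\<lambda>s. f_val p s m n' b) \<longlonglongrightarrow> 0) \<and>
         ((\<Sum>i. of_nat (b (Suc i)) :: ennreal) \<noteq> \<infinity> \<longrightarrow>
            finite {i. 1 \<le> i \<and> b i \<noteq> 0} \<and>
            (let r = card {i. 1 \<le> i \<and> b i \<noteq> 0} in
              b (r + 1) = 0 \<and>
              (\<lambda>s. f_val p s m n' b) \<longlonglongrightarrow>
                real p powi (- int (\<Sum>i=1..r. (n' + b i) * b i)) *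
                ((br p (n' + m) * br p m) /
                 (br p n' * (\<Prod>i=1..r+1. br p (b (i - 1) - b i))))))"
proof -
  let ?f = "\<lambda>s. f_val p s m n' b"
  have dec: "decseq b" using assms(4) by (simp add: decseq_Suc_iff)
  have p: "p > 1" "p > 0" using assms(2) prime_gt_1_nat prime_gt_0_nat by auto
  have diverging: "?f \<longlonglongrightarrow> 0" if pos: "\<forall>i. b i \<noteq> 0"
  proof -
    obtain N where N: "\<And>i. i \<ge> N \<Longrightarrow> b i = b N"
      using decseq_nat_eventually_constant[OF dec] by blast
    let ?q = "real p powi (- int ((n' + b N) * b N))"
    have "(n' + b N) * b N > 0" using pos by simp
    then have "\<bar>?q\<bar> < 1"
      using p by (simp add: power_int_minus inverse_less_1_iff one_less_power power_int_of_nat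
          del: of_nat_mult of_nat_add)
    then have "(\<lambda>k. ?f N * ?q ^ k) \<longlonglongrightarrow> 0"
      by (intro tendsto_mult_right_zero LIMSEQ_power_zero) (simp only: real_norm_def)
    then have "(\<lambda>k. ?f (k + N)) \<longlonglongrightarrow> 0"
      using f_val_geometric[of p b m N "b N", OF p(2) assms(3) N] by (simp add: add.commute)
    then show ?thesis by (rule LIMSEQ_offset)
  qed
  have converging: "finite {i. 1 \<le> i \<and> b i \<noteq> 0} \<and>
      (let r = card {i. 1 \<le> i \<and> b i \<noteq> 0} in b (r + 1) = 0 \<and>
        ?f \<longlonglongrightarrow> real p powi (- int (\<Sum>i=1..r. (n' + b i) * b i)) *
          ((br p (n' + m) * br p m) / (br p n' * (\<Prod>i=1..r+1. br p (b (i - 1) - b i)))))"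
    if ex0: "\<not> (\<forall>i. b i \<noteq> 0)"
  proof -
    (* b 0 = m > 0, so the first zero of b has a predecessor, and that is r *)
    define k where "k = (LEAST i. b i = 0)"
    have bk: "b k = 0" unfolding k_def by (rule LeastI_ex) (use ex0 in metis)
    then obtain r where r: "k = Suc r" using assms(1,3) by (cases k) auto
    have before: "b i \<noteq> 0" if "i \<le> r" for i
      using that not_less_Least[of i "\<lambda>i. b i = 0"] r unfolding k_def by simp
    have after: "b i = 0" if "i \<ge> Suc r" for i
      using decseqD[OF dec that] bk r by simp
    have nonzero_iff: "b i \<noteq> 0 \<longleftrightarrow> i \<le> r" for i
      using before[of i] after[of i] by (cases "i \<le> r") auto
    have set: "{i. 1 \<le> i \<and> b i \<noteq> 0} = {1..r}"
      unfolding nonzero_iff by auto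
    have "?f (k' + Suc r) = ?f (Suc r)" for k'
      using f_val_geometric[of p b m "Suc r" 0 k' n', OF p(2) assms(3) after] by (simp add: add.commute)
    then have "?f \<longlonglongrightarrow> ?f (Suc r)" by (intro LIMSEQ_offset[of ?f "Suc r"]) simp
    then show ?thesis
      unfolding set Let_def
      using after[of "Suc r"] f_val_Suc_eq_if_zero[of b m r p n', OF assms(3)] by simp
  qed
  show ?thesis
    unfolding suminf_decreasing_nat_eq_top_iff[OF dec]
    by (rule conjI[OF impI[OF diverging] impI[OF converging]])
qed

end
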